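(* Let $n>k$ be positive integers, let $X$ be a real $n\times k$ matrix with $\mathrm{rank}(X)=k$, let $Z$ be a fixed real $n\times(n-k)$ matrix with $X^\top Z=0$ and $\mathrm{rank}(Z)=n-k$, and let $\Omega$ be a real symmetric positive definite $n\times n$ matrix, expressed as $$\Omega=\begin{pmatrix}X&Z\end{pmatrix}\begin{pmatrix}\Gamma&\Xi\\ \Xi^\top&\Delta\end{pmatrix}\begin{pmatrix}X^\top\\ Z^\top\end{pmatrix}$$ with $\Gamma$ symmetric positive definite $k\times k$, $\Xi$ real $k\times(n-k)$, and $\Delta$ symmetric positive definite $(n-k)\times(n-k)$. Put $A=(\Gamma-\Xi\Delta^{-1}\Xi^\top)^{-1}$. Let $K_1,K_2$ be given real symmetric positive semidefinite $k\times k$ matrices. Then $$RSS(\Omega,K_1)=RSS(I_n,K_2)\quad\text{for every } y\in\mathbb{R}^n$$ holds if and only if the following three conditions hold simultaneously: $$K_1(A+K_1)^{-1}A(A+K_1)^{-1}K_1=K_2(X^\top X+K_2)^{-1}X^\top X(X^\top X+K_2)^{-1}K_2,$$ $$K_2(X^\top X+K_2)^{-1}K_2\,\Xi=0,$$ $$\Delta=(Z^\top Z)^{-1}.$$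
   Context: For a symmetric positive definite $n\times n$ matrix $\Phi$, a symmetric positive semidefinite $k\times k$ matrix $K$ and $y\in\mathbb{R}^n$, the general ridge estimator is $$\hat{\beta}(\Phi,K)=(X^\top\Phi^{-1}X+K)^{-1}X^\top\Phi^{-1}y,$$ and the corresponding (generalized) residual sum of squares is $$RSS(\Phi,K)=\big(y-X\hat{\beta}(\Phi,K)\big)^\top\Phi^{-1}\big(y-X\hat{\beta}(\Phi,K)\big).$$ $I_n$ is the $n\times n$ identity matrix. The displayed block representation of $\Omega$ always exists, with $\Gamma=(X^\top X)^{-1}X^\top\Omega X(X^\top X)^{-1}$, $\Xi=(X^\top X)^{-1}X^\top\Omega Z(Z^\top Z)^{-1}$, $\Delta=(Z^\top Z)^{-1}Z^\top\Omega Z(Z^\top Z)^{-1}$. *)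

theory Defs
  imports "HOL-Analysis.Analysis"
begin

definition symmetric_matrix :: "real ^ 'n ^ 'n \<Rightarrow> bool" where
  "symmetric_matrix M \<longleftrightarrow> transpose M = M"

definition spd_matrix :: "real ^ 'n ^ 'n \<Rightarrow> bool" where
  "spd_matrix M \<longleftrightarrow> symmetric_matrix M \<and> (\<forall>x. x \<noteq> 0 \<longrightarrow> x \<bullet> (M *v x) > 0)"

definition spsd_matrix :: "real ^ 'n ^ 'n \<Rightarrow> bool" where
  "spsd_matrix M \<longleftrightarrow> symmetric_matrix M \<and> (\<forall>x. x \<bullet> (M *v x) \<ge> 0)"

(* Block matrices are indexed by sum types: Inl selects the first block of rows or
   columns, Inr the second. A matrix with n rows and k columns has type real ^ 'k ^ 'n. *)

definition hcat_matrix ::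
  "real ^ 'k ^ 'n \<Rightarrow> real ^ 'm ^ 'n \<Rightarrow> real ^ ('k + 'm) ^ 'n" where
  "hcat_matrix P Q = (\<chi> i j. case j of Inl c \<Rightarrow> P $ i $ c | Inr d \<Rightarrow> Q $ i $ d)"

definition vcat_matrix ::
  "real ^ 'n ^ 'k \<Rightarrow> real ^ 'n ^ 'm \<Rightarrow> real ^ 'n ^ ('k + 'm)" where
  "vcat_matrix P Q = (\<chi> i j. case i of Inl c \<Rightarrow> P $ c $ j | Inr d \<Rightarrow> Q $ d $ j)"

definition four_block_matrix ::
  "real ^ 'k ^ 'k \<Rightarrow> real ^ 'm ^ 'k \<Rightarrow> real ^ 'k ^ 'm \<Rightarrow> real ^ 'm ^ 'm
     \<Rightarrow> real ^ ('k + 'm) ^ ('k + 'm)" where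
  "four_block_matrix P Q R S = vcat_matrix (hcat_matrix P Q) (hcat_matrix R S)"

definition ridge_estimator ::
  "real ^ 'k ^ 'n \<Rightarrow> real ^ 'n \<Rightarrow> real ^ 'n ^ 'n \<Rightarrow> real ^ 'k ^ 'k \<Rightarrow> real ^ 'k" where
  "ridge_estimator X y \<Phi> K =
     (matrix_inv (transpose X ** matrix_inv \<Phi> ** X + K) ** transpose X ** matrix_inv \<Phi>) *v y"

definition RSS ::
  "real ^ 'k ^ 'n \<Rightarrow> real ^ 'n \<Rightarrow> real ^ 'n ^ 'n \<Rightarrow> real ^ 'k ^ 'k \<Rightarrow> real" where
  "RSS X y \<Phi> K =
     (y - X *v ridge_estimator X y \<Phi> K) \<bullet>
       (matrix_inv \<Phi> *v (y - X *v ridge_estimator X y \<Phi> K))"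

end

theory Submission
  imports Defs
begin

text \<open>
  The columns of \<open>X\<close> and \<open>Z\<close> together form a basis of the whole space, so write
  \<open>y = X a + Z b\<close>. In these coordinates both residual sums of squares become explicit quadratic
  forms. Put \<open>H = \<Xi> \<Delta>\<^sup>-\<^sup>1\<close> and \<open>u = a - H b\<close>. Block elimination gives
  \<open>y\<^sup>T \<Omega>\<^sup>-\<^sup>1 y = u\<^sup>T A u + b\<^sup>T \<Delta>\<^sup>-\<^sup>1 b\<close>, where \<open>A\<close> is the inverse of the Schur complement of \<open>\<Delta>\<close>;
  it also gives \<open>X\<^sup>T \<Omega>\<^sup>-\<^sup>1 y = A u\<close>, and in particular \<open>X\<^sup>T \<Omega>\<^sup>-\<^sup>1 X = A\<close>. Hence the ridge estimator is
  \<open>\<beta> = (A + K)\<^sup>-\<^sup>1 A u\<close>. Subtracting \<open>X \<beta>\<close> from \<open>y\<close> leaves \<open>b\<close> alone and turns \<open>u\<close> into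
  \<open>u - \<beta> = (A + K)\<^sup>-\<^sup>1 K u\<close>, so that
  \<open>RSS(\<Omega>, K) = u\<^sup>T L(A, K) u + b\<^sup>T \<Delta>\<^sup>-\<^sup>1 b\<close> with \<open>L(A, K) = K (A + K)\<^sup>-\<^sup>1 A (A + K)\<^sup>-\<^sup>1 K\<close>
  (lemma \<open>RSS_coordinates\<close>).

  The identity matrix has a block representation of the same kind, with \<open>(X\<^sup>T X)\<^sup>-\<^sup>1\<close>, \<open>0\<close> and
  \<open>(Z\<^sup>T Z)\<^sup>-\<^sup>1\<close> in place of \<open>\<Gamma>\<close>, \<open>\<Xi>\<close> and \<open>\<Delta>\<close> (lemma \<open>block_covariance_identity\<close>). The same formula
  therefore gives \<open>RSS(I, K) = a\<^sup>T L(X\<^sup>T X, K) a + b\<^sup>T Z\<^sup>T Z b\<close>.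

  It remains to see when two such forms agree for all \<open>a\<close> and \<open>b\<close> (lemma \<open>shifted_form_eq_iff\<close>).
  Taking \<open>b = 0\<close> forces the two matrices \<open>L\<close> to coincide, which is the first condition. The mixed
  term \<open>a\<^sup>T L H b\<close> must then vanish, that is \<open>L \<Xi> = 0\<close>; as \<open>L(A, K)\<close> has the same kernel as
  \<open>K (A + K)\<^sup>-\<^sup>1 K\<close> (lemma \<open>ridge_residual_form_kernel\<close>), this is the second condition. What is left
  is \<open>\<Delta>\<^sup>-\<^sup>1 = Z\<^sup>T Z\<close>, the third.
\<close>

text \<open>
  By default products \<open>transpose M *v x\<close> are rewritten to \<open>x v* M\<close>. Keeping the first form lets
  the associativity and distributivity rules for \<open>*v\<close> apply to adjoints as well.
\<close>

declare transpose_matrix_vector [simp del]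

section \<open>Quadratic forms and positive definite matrices\<close>

lemma dot_matrix_vector_transpose:
  fixes M :: "real ^ 'b ^ 'a"
  shows "x \<bullet> (M *v y) = (transpose M *v x) \<bullet> y"
  by (metis dot_lmul_matrix transpose_matrix_vector)

lemma dot_symmetric_matrix:
  assumes "symmetric_matrix M"
  shows "x \<bullet> (M *v y) = (M *v x) \<bullet> y"
  using assms dot_matrix_vector_transpose[of x M y] by (simp add: symmetric_matrix_def)

text \<open>
  Polarization: a symmetric bilinear form is recovered from its values on the diagonal.
\<close>

lemma symmetric_matrix_eqI:
  fixes M N :: "real ^ 'a ^ 'a"
  assumes M: "symmetric_matrix M" and N: "symmetric_matrix N"
    and eq: "\<And>x. x \<bullet> (M *v x) = x \<bullet> (N *v x)"
  shows "M = N"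
proof -
  have "x \<bullet> (M *v y) = x \<bullet> (N *v y)" for x y
  proof -
    have "2 * (x \<bullet> (M *v y)) = (x + y) \<bullet> (M *v (x + y)) - x \<bullet> (M *v x) - y \<bullet> (M *v y)"
      by (simp add: matrix_vector_right_distrib inner_add dot_symmetric_matrix[OF M, of x y]
          inner_commute)
    also have "\<dots> = 2 * (x \<bullet> (N *v y))"
      unfolding eq
      by (simp add: matrix_vector_right_distrib inner_add dot_symmetric_matrix[OF N, of x y]
          inner_commute)
    finally show ?thesis by simp
  qed
  then have "M *v y = N *v y" for y
    using vector_eq_ldot by blast
  then show ?thesis by (simp add: matrix_eq)
qed

lemma matrix_inv_cancel:
  fixes M :: "real ^ 'a ^ 'a"
  assumes "invertible M"
  shows "M *v (matrix_inv M *v x) = x" "matrix_inv M *v (M *v x) = x"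
proof -
  have "M ** matrix_inv M = mat 1 \<and> matrix_inv M ** M = mat 1"
    using assms unfolding invertible_def matrix_inv_def by (rule someI_ex)
  then show "M *v (matrix_inv M *v x) = x" "matrix_inv M *v (M *v x) = x"
    by (simp_all add: matrix_vector_mul_assoc)
qed

lemma matrix_inv_eqI:
  fixes M N :: "real ^ 'a ^ 'a"
  assumes "invertible M" "\<And>x. M *v (N *v x) = x"
  shows "matrix_inv M = N"
  unfolding matrix_eq using assms matrix_inv_cancel(2) by metis

lemma spd_matrix_symmetric: "spd_matrix M \<Longrightarrow> symmetric_matrix M"
  by (simp add: spd_matrix_def)

lemma spsd_matrix_symmetric: "spsd_matrix M \<Longrightarrow> symmetric_matrix M"
  by (simp add: spsd_matrix_def)

lemma spd_matrix_eq_0: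
  assumes "spd_matrix M" "x \<bullet> (M *v x) = 0"
  shows "x = 0"
  using assms by (metis less_irrefl spd_matrix_def)

lemma invertible_spd_matrix:
  assumes "spd_matrix M"
  shows "invertible M"
proof -
  have "x = 0" if "M *v x = 0" for x
    using spd_matrix_eq_0[OF assms, of x] that by simp
  then show ?thesis
    by (metis invertible_left_inverse matrix_left_invertible_ker)
qed

lemma symmetric_matrix_inv:
  assumes "spd_matrix M"
  shows "symmetric_matrix (matrix_inv M)"
proof -
  note inv = matrix_inv_cancel[OF invertible_spd_matrix[OF assms]]
  have "x \<bullet> (transpose (matrix_inv M) *v y) = x \<bullet> (matrix_inv M *v y)" for x y
  proof -
    have "x \<bullet> (matrix_inv M *v y) = (M *v (matrix_inv M *v x)) \<bullet> (matrix_inv M *v y)"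
      by (simp add: inv)
    also have "\<dots> = (matrix_inv M *v x) \<bullet> y"
      using dot_symmetric_matrix[OF spd_matrix_symmetric[OF assms]] inv by metis
    finally show ?thesis
      by (simp add: dot_matrix_vector_transpose[of x "transpose (matrix_inv M)"])
  qed
  then show ?thesis
    unfolding symmetric_matrix_def matrix_eq using vector_eq_ldot by blast
qed

lemma spd_matrix_inv:
  assumes "spd_matrix M"
  shows "spd_matrix (matrix_inv M)"
  unfolding spd_matrix_def
proof (intro conjI allI impI symmetric_matrix_inv assms)
  fix x :: "real ^ 'a" assume "x \<noteq> 0"
  note inv = matrix_inv_cancel[OF invertible_spd_matrix[OF assms]]
  have "matrix_inv M *v x \<noteq> 0"
    using inv(1)[of x] \<open>x \<noteq> 0\<close> by auto
  then have "(matrix_inv M *v x) \<bullet> (M *v (matrix_inv M *v x)) > 0"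
    using assms by (simp add: spd_matrix_def)
  then show "x \<bullet> (matrix_inv M *v x) > 0"
    by (simp add: inv inner_commute)
qed

lemma symmetric_matrix_add:
  "symmetric_matrix M \<Longrightarrow> symmetric_matrix N \<Longrightarrow> symmetric_matrix (M + N)"
  by (simp add: symmetric_matrix_def transpose_def vec_eq_iff)

lemma symmetric_matrix_diff:
  "symmetric_matrix M \<Longrightarrow> symmetric_matrix N \<Longrightarrow> symmetric_matrix (M - N)"
  by (simp add: symmetric_matrix_def transpose_def vec_eq_iff)

lemma symmetric_matrix_congruence:
  "symmetric_matrix M \<Longrightarrow> symmetric_matrix (B ** M ** transpose B)"
  by (simp add: symmetric_matrix_def matrix_transpose_mul matrix_mul_assoc)

lemma spd_add_spsd_matrix:
  assumes "spd_matrix M" "spsd_matrix K"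
  shows "spd_matrix (M + K)"
  using assms unfolding spd_matrix_def spsd_matrix_def
  by (simp add: symmetric_matrix_add matrix_vector_mult_add_rdistrib inner_add_right
      add_pos_nonneg)

lemma spd_gram_matrix:
  fixes X :: "real ^ 'k ^ 'n"
  assumes "rank X = CARD('k)"
  shows "spd_matrix (transpose X ** X)"
  unfolding spd_matrix_def
proof (intro conjI allI impI)
  show "symmetric_matrix (transpose X ** X)"
    by (simp add: symmetric_matrix_def matrix_transpose_mul)
next
  fix x :: "real ^ 'k" assume "x \<noteq> 0"
  have "inj ((*v) X)"
    using assms full_rank_injective by blast
  with \<open>x \<noteq> 0\<close> have "X *v x \<noteq> 0"
    by (metis injD matrix_vector_mult_0_right)
  then show "x \<bullet> (transpose X ** X *v x) > 0"
    by (simp add: dot_matrix_vector_transpose[of x "transpose X"]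
        flip: matrix_vector_mul_assoc)
qed

lemma transpose_zero: "transpose (0 :: real ^ 'a ^ 'b) = 0"
  by (simp add: transpose_def vec_eq_iff)

lemma orthogonal_columns_commute:
  fixes X :: "real ^ 'k ^ 'n" and Z :: "real ^ 'm ^ 'n"
  assumes "transpose X ** Z = 0"
  shows "transpose Z ** X = 0"
proof -
  have "transpose Z ** X = transpose (transpose X ** Z)"
    by (simp add: matrix_transpose_mul)
  also have "\<dots> = 0"
    unfolding assms by (rule transpose_zero)
  finally show ?thesis .
qed

section \<open>Residual forms of ridge regression\<close>

text \<open>
  The quadratic form of the weighted residual left by ridge shrinkage: with
  \<open>r = (A + K)\<^sup>-\<^sup>1 K u\<close> the form takes the value \<open>r\<^sup>T A r\<close> at \<open>u\<close>.
\<close>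

definition ridge_residual_form :: "real ^ 'k ^ 'k \<Rightarrow> real ^ 'k ^ 'k \<Rightarrow> real ^ 'k ^ 'k" where
  "ridge_residual_form A K =
     K ** matrix_inv (A + K) ** A ** matrix_inv (A + K) ** K"

lemma ridge_residual_form_dot:
  fixes A K :: "real ^ 'k ^ 'k"
  assumes A: "spd_matrix A" and K: "spsd_matrix K"
  shows "x \<bullet> (ridge_residual_form A K *v y) =
    (matrix_inv (A + K) *v (K *v x)) \<bullet> (A *v (matrix_inv (A + K) *v (K *v y)))"
  using dot_symmetric_matrix[OF spsd_matrix_symmetric[OF K]]
    dot_symmetric_matrix[OF symmetric_matrix_inv[OF spd_add_spsd_matrix[OF A K]]]
  by (simp add: ridge_residual_form_def flip: matrix_vector_mul_assoc)

lemma symmetric_ridge_residual_form: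
  assumes A: "spd_matrix A" and K: "spsd_matrix K"
  shows "symmetric_matrix (ridge_residual_form A K)"
  using spd_matrix_symmetric[OF A] spsd_matrix_symmetric[OF K]
    symmetric_matrix_inv[OF spd_add_spsd_matrix[OF A K]]
  by (simp add: ridge_residual_form_def symmetric_matrix_def matrix_transpose_mul matrix_mul_assoc)

text \<open>
  Expand \<open>u = (A + K)\<^sup>-\<^sup>1 (A + K) u\<close>. The left side is the error made when \<open>u\<close> is estimated by its
  shrunken version.
\<close>

lemma ridge_shrinkage_residual:
  fixes A K :: "real ^ 'k ^ 'k"
  assumes A: "spd_matrix A" and K: "spsd_matrix K"
  shows "u - matrix_inv (A + K) *v (A *v u) = matrix_inv (A + K) *v (K *v u)"
proof -
  have "u = matrix_inv (A + K) *v ((A + K) *v u)"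
    by (simp add: matrix_inv_cancel[OF invertible_spd_matrix[OF spd_add_spsd_matrix[OF A K]]])
  then show ?thesis
    by (simp add: matrix_vector_mult_add_rdistrib matrix_vector_right_distrib algebra_simps)
qed

text \<open>
  Both matrices arise by congruence from a positive definite one: the first is \<open>(N K)\<^sup>T A (N K)\<close> and the second is
  \<open>K\<^sup>T N K\<close>, where \<open>N = (A + K)\<^sup>-\<^sup>1\<close>. Since \<open>A\<close> and \<open>N\<close> are positive definite, each of them
  annihilates exactly the kernel of \<open>K\<close>.
\<close>

lemma ridge_residual_form_kernel:
  assumes A: "spd_matrix A" and K: "spsd_matrix K"
  shows "ridge_residual_form A K *v x = 0 \<longleftrightarrow> K ** matrix_inv (A + K) ** K *v x = 0"
proof -
  let ?N = "matrix_inv (A + K)"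
  have N: "spd_matrix ?N" by (intro spd_matrix_inv spd_add_spsd_matrix A K)
  note inv = matrix_inv_cancel[OF invertible_spd_matrix[OF spd_add_spsd_matrix[OF A K]]]
  have "?N *v (K *v x) = 0" if "ridge_residual_form A K *v x = 0"
    using ridge_residual_form_dot[OF A K, of x x] that by (simp add: spd_matrix_eq_0[OF A])
  moreover have "?N *v (K *v x) = 0" if *: "K ** ?N ** K *v x = 0"
  proof -
    have "(K *v x) \<bullet> (?N *v (K *v x)) = x \<bullet> (K ** ?N ** K *v x)"
      using dot_symmetric_matrix[OF spsd_matrix_symmetric[OF K]]
      by (simp flip: matrix_vector_mul_assoc)
    then have "K *v x = 0" by (intro spd_matrix_eq_0[OF N]) (simp add: *)
    then show ?thesis by simp
  qed
  ultimately show ?thesis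
    by (auto simp: ridge_residual_form_def simp flip: matrix_vector_mul_assoc)
qed

lemma matrix_mult_eq_0_iff: "M ** B = 0 \<longleftrightarrow> (\<forall>x. M *v (B *v x) = (0 :: real ^ 'a))"
  by (simp add: matrix_eq matrix_vector_mul_assoc)

section \<open>Block coordinates\<close>

lemma hcat_matrix_vector_mult:
  "hcat_matrix P Q *v v = P *v (\<chi> i. v $ Inl i) + Q *v (\<chi> i. v $ Inr i)"
  by (simp add: vec_eq_iff matrix_vector_mult_def hcat_matrix_def UNIV_Plus_UNIV[symmetric]
      sum.Plus del: UNIV_Plus_UNIV)

lemma vcat_matrix_vector_mult:
  "(\<chi> i. (vcat_matrix P Q *v v) $ Inl i) = P *v v"
  "(\<chi> i. (vcat_matrix P Q *v v) $ Inr i) = Q *v v"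
  by (simp_all add: vec_eq_iff matrix_vector_mult_def vcat_matrix_def)

lemma block_congruence_vector_mult:
  "(hcat_matrix X Z ** four_block_matrix \<Gamma> \<Xi> \<Xi>' \<Delta> ** vcat_matrix (transpose X) (transpose Z)) *v w
   = X *v (\<Gamma> *v (transpose X *v w) + \<Xi> *v (transpose Z *v w))
     + Z *v (\<Xi>' *v (transpose X *v w) + \<Delta> *v (transpose Z *v w))"
  by (simp add: hcat_matrix_vector_mult vcat_matrix_vector_mult four_block_matrix_def
      flip: matrix_vector_mul_assoc)


text \<open>
  The block representation of a covariance matrix along two mutually orthogonal column spaces. As
  a locale it can be instantiated twice, for \<open>\<Omega>\<close> and for the identity, so that the residual sum of
  squares has to be computed only once.
\<close>

locale block_covariance =
  fixes X :: "real ^ 'k ^ 'n"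
    and Z :: "real ^ 'm ^ 'n"
    and \<Omega> :: "real ^ 'n ^ 'n"
    and \<Gamma> :: "real ^ 'k ^ 'k"
    and \<Xi> :: "real ^ 'm ^ 'k"
    and \<Delta> :: "real ^ 'm ^ 'm"
  assumes rank_X: "rank X = CARD('k)"
    and rank_Z: "rank Z = CARD('m)"
    and orthogonal: "transpose X ** Z = 0"
    and spd_\<Omega>: "spd_matrix \<Omega>"
    and spd_\<Delta>: "spd_matrix \<Delta>"
    and symmetric_\<Gamma>: "symmetric_matrix \<Gamma>"
    and block_\<Omega>: "\<Omega> = hcat_matrix X Z ** four_block_matrix \<Gamma> \<Xi> (transpose \<Xi>) \<Delta>
               ** vcat_matrix (transpose X) (transpose Z)"
begin

definition schur :: "real ^ 'k ^ 'k" where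
  "schur = \<Gamma> - \<Xi> ** matrix_inv \<Delta> ** transpose \<Xi>"

text \<open>
  The coordinate \<open>a\<close> after the part predicted by \<open>b\<close> is removed: \<open>\<Xi> \<Delta>\<^sup>-\<^sup>1 b\<close> is the regression of the
  first block on the second when the blocks have joint covariance \<open>\<Gamma>, \<Xi>, \<Delta>\<close>.
\<close>

definition partial_coeff :: "real ^ 'k \<Rightarrow> real ^ 'm \<Rightarrow> real ^ 'k" where
  "partial_coeff a b = a - \<Xi> *v (matrix_inv \<Delta> *v b)"

lemmas inverse_gram_X = matrix_inv_cancel[OF invertible_spd_matrix[OF spd_gram_matrix[OF rank_X]]]
lemmas inverse_gram_Z = matrix_inv_cancel[OF invertible_spd_matrix[OF spd_gram_matrix[OF rank_Z]]]
lemmas inverse_\<Delta> = matrix_inv_cancel[OF invertible_spd_matrix[OF spd_\<Delta>]]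
lemmas inverse_\<Omega> = matrix_inv_cancel[OF invertible_spd_matrix[OF spd_\<Omega>]]

lemma orthogonal_vector:
  "transpose X *v (Z *v b) = 0" "transpose Z *v (X *v a) = 0"
proof -
  have "transpose Z ** X = 0"
    by (rule orthogonal_columns_commute[OF orthogonal])
  then show "transpose X *v (Z *v b) = 0" "transpose Z *v (X *v a) = 0"
    by (simp_all add: matrix_vector_mul_assoc orthogonal)
qed

lemma coordinates_unique:
  assumes "X *v a + Z *v b = X *v a' + Z *v b'"
  shows "a = a'" "b = b'"
proof -
  have "transpose X *v (X *v a) = transpose X *v (X *v a')"
    using arg_cong[OF assms, of "(*v) (transpose X)"]
    by (simp add: matrix_vector_right_distrib orthogonal_vector)
  then show "a = a'"
    using inverse_gram_X(2) by (metis matrix_vector_mul_assoc)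
  have "transpose Z *v (Z *v b) = transpose Z *v (Z *v b')"
    using arg_cong[OF assms, of "(*v) (transpose Z)"]
    by (simp add: matrix_vector_right_distrib orthogonal_vector)
  then show "b = b'"
    using inverse_gram_Z(2) by (metis matrix_vector_mul_assoc)
qed

lemma \<Omega>_vector:
  "\<Omega> *v w = X *v (\<Gamma> *v (transpose X *v w) + \<Xi> *v (transpose Z *v w))
    + Z *v (transpose \<Xi> *v (transpose X *v w) + \<Delta> *v (transpose Z *v w))"
  by (simp add: block_\<Omega> block_congruence_vector_mult)

text \<open>
  The matrix \<open>\<Omega>\<close> is onto, and its block form shows that its range lies in the
  sum of the two column spaces.
\<close>

lemma coordinates_exist:
  obtains a b where "y = X *v a + Z *v b"
  using \<Omega>_vector[of "matrix_inv \<Omega> *v y"] inverse_\<Omega>(1)[of y] by metis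

lemma schur_vector:
  "schur *v p = \<Gamma> *v p - \<Xi> *v (matrix_inv \<Delta> *v (transpose \<Xi> *v p))"
  by (simp add: schur_def matrix_vector_mult_diff_rdistrib flip: matrix_vector_mul_assoc)

text \<open>
  The value of the Schur complement at \<open>p\<close> is the value of \<open>\<Omega>\<close> at the vector \<open>w\<close> that has
  \<open>X\<^sup>T w = p\<close> and \<open>Z\<^sup>T w = -\<Delta>\<^sup>-\<^sup>1 \<Xi>\<^sup>T p\<close>. This choice of the second component makes the \<open>Z\<close>-part of
  \<open>\<Omega> w\<close> vanish.
\<close>

lemma spd_schur: "spd_matrix schur"
  unfolding spd_matrix_def
proof (intro conjI allI impI)
  show "symmetric_matrix schur"
    unfolding schur_def
    by (intro symmetric_matrix_diff symmetric_\<Gamma> symmetric_matrix_congruence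
        symmetric_matrix_inv spd_\<Delta>)
next
  fix p :: "real ^ 'k" assume "p \<noteq> 0"
  define q where "q = - (matrix_inv \<Delta> *v (transpose \<Xi> *v p))"
  define w where "w = X *v (matrix_inv (transpose X ** X) *v p)
    + Z *v (matrix_inv (transpose Z ** Z) *v q)"
  have Xw: "transpose X *v w = p" and Zw: "transpose Z *v w = q"
    using inverse_gram_X(1)[of p] inverse_gram_Z(1)[of q]
    by (simp_all add: w_def matrix_vector_right_distrib orthogonal_vector
        flip: matrix_vector_mul_assoc)
  have "\<Omega> *v w = X *v (schur *v p)"
    unfolding \<Omega>_vector Xw Zw schur_vector
    by (simp add: q_def inverse_\<Delta> vec.neg)
  then have "w \<bullet> (\<Omega> *v w) = p \<bullet> (schur *v p)"
    by (simp add: dot_matrix_vector_transpose[of w X] Xw)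
  moreover have "w \<noteq> 0"
    using Xw \<open>p \<noteq> 0\<close> by auto
  ultimately show "p \<bullet> (schur *v p) > 0"
    using spd_\<Omega> by (metis spd_matrix_def)
qed

lemmas inverse_schur = matrix_inv_cancel[OF invertible_spd_matrix[OF spd_schur]]

text \<open>
  Block elimination, carried out on vectors so that the inverse of the block matrix never has to be
  written down: with \<open>w = \<Omega>\<^sup>-\<^sup>1 y\<close>, the unknowns \<open>p = X\<^sup>T w\<close> and \<open>q = Z\<^sup>T w\<close> solve
  \<open>\<Gamma> p + \<Xi> q = a\<close> and \<open>\<Xi>\<^sup>T p + \<Delta> q = b\<close>.
\<close>

lemma precision_coordinates:
  assumes y: "y = X *v a + Z *v b"
  shows "transpose X *v (matrix_inv \<Omega> *v y) = matrix_inv schur *v partial_coeff a b"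
    and "transpose Z *v (matrix_inv \<Omega> *v y) =
      matrix_inv \<Delta> *v (b - transpose \<Xi> *v (matrix_inv schur *v partial_coeff a b))"
proof -
  let ?p = "transpose X *v (matrix_inv \<Omega> *v y)" and ?q = "transpose Z *v (matrix_inv \<Omega> *v y)"
  have eqs: "\<Gamma> *v ?p + \<Xi> *v ?q = a" "transpose \<Xi> *v ?p + \<Delta> *v ?q = b"
    using coordinates_unique \<Omega>_vector[of "matrix_inv \<Omega> *v y"] inverse_\<Omega>(1)[of y] y by metis+
  have "\<Delta> *v ?q = b - transpose \<Xi> *v ?p"
    using eqs(2) by (metis add_diff_cancel_left')
  then have q: "?q = matrix_inv \<Delta> *v (b - transpose \<Xi> *v ?p)"
    using inverse_\<Delta>(2) by metis
  have "schur *v ?p = partial_coeff a b"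
    using eqs(1) unfolding q
    by (simp add: schur_vector partial_coeff_def matrix_vector_mult_diff_distrib algebra_simps)
  then show p: "?p = matrix_inv schur *v partial_coeff a b"
    using inverse_schur(2) by metis
  show "?q = matrix_inv \<Delta> *v (b - transpose \<Xi> *v (matrix_inv schur *v partial_coeff a b))"
    using q unfolding p .
qed

lemma precision_form:
  assumes y: "y = X *v a + Z *v b"
  shows "y \<bullet> (matrix_inv \<Omega> *v y) =
    partial_coeff a b \<bullet> (matrix_inv schur *v partial_coeff a b) + b \<bullet> (matrix_inv \<Delta> *v b)"
proof -
  let ?p = "matrix_inv schur *v partial_coeff a b"
  have "y \<bullet> (matrix_inv \<Omega> *v y) = a \<bullet> ?p + b \<bullet> (matrix_inv \<Delta> *v (b - transpose \<Xi> *v ?p))"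
    using precision_coordinates[OF y]
      dot_matrix_vector_transpose[of "matrix_inv \<Omega> *v y" X a]
      dot_matrix_vector_transpose[of "matrix_inv \<Omega> *v y" Z b]
    by (simp add: y inner_add_left inner_commute)
  also have "b \<bullet> (matrix_inv \<Delta> *v (b - transpose \<Xi> *v ?p)) =
      b \<bullet> (matrix_inv \<Delta> *v b) - (\<Xi> *v (matrix_inv \<Delta> *v b)) \<bullet> ?p"
    using dot_symmetric_matrix[OF symmetric_matrix_inv[OF spd_\<Delta>]]
      dot_matrix_vector_transpose[of _ "transpose \<Xi>"]
    by (simp add: matrix_vector_mult_diff_distrib inner_diff_right)
  finally show ?thesis
    by (simp add: partial_coeff_def inner_diff_left)
qed

lemma precision_gram: "transpose X ** matrix_inv \<Omega> ** X = matrix_inv schur"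
  using precision_coordinates(1)[where b = 0]
  by (simp add: matrix_eq partial_coeff_def flip: matrix_vector_mul_assoc)

text \<open>
  The residual \<open>y - X \<beta>\<close> has coordinates \<open>a - \<beta>\<close> and \<open>b\<close>, so its partial coefficient is the one of
  \<open>y\<close> shifted by \<open>\<beta>\<close>, which is a shrinkage residual.
\<close>

lemma RSS_coordinates:
  assumes K: "spsd_matrix K"
  shows "RSS X (X *v a + Z *v b) \<Omega> K =
    partial_coeff a b \<bullet> (ridge_residual_form (matrix_inv schur) K *v partial_coeff a b)
      + b \<bullet> (matrix_inv \<Delta> *v b)"
proof -
  define y where "y = X *v a + Z *v b"
  let ?A = "matrix_inv schur" and ?u = "partial_coeff a b"
  let ?\<beta> = "ridge_estimator X y \<Omega> K"
  note A = spd_matrix_inv[OF spd_schur]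
  have beta: "?\<beta> = matrix_inv (?A + K) *v (?A *v ?u)"
    by (simp add: ridge_estimator_def precision_gram precision_coordinates(1)[OF y_def]
        flip: matrix_vector_mul_assoc)
  have res: "y - X *v ?\<beta> = X *v (a - ?\<beta>) + Z *v b"
    by (simp add: y_def matrix_vector_mult_diff_distrib)
  have "partial_coeff (a - ?\<beta>) b = ?u - ?\<beta>"
    by (simp add: partial_coeff_def)
  also have "\<dots> = matrix_inv (?A + K) *v (K *v ?u)"
    unfolding beta by (rule ridge_shrinkage_residual[OF A K])
  finally show ?thesis
    by (simp add: RSS_def precision_form[OF res] ridge_residual_form_dot[OF A K] flip: y_def)
qed

end

text \<open>
  This is \<open>I = X (X\<^sup>T X)\<^sup>-\<^sup>1 X\<^sup>T + Z (Z\<^sup>T Z)\<^sup>-\<^sup>1 Z\<^sup>T\<close>, the sum of the orthogonal projections onto the two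
  column spaces; it holds because they span the whole space.
\<close>

lemma block_covariance_identity:
  fixes X :: "real ^ 'k ^ 'n" and Z :: "real ^ 'm ^ 'n"
  assumes "rank X = CARD('k)" "rank Z = CARD('m)" "transpose X ** Z = 0"
    and spanning: "\<And>y. \<exists>a b. y = X *v a + Z *v b"
  shows "block_covariance X Z (mat 1) (matrix_inv (transpose X ** X)) 0
    (matrix_inv (transpose Z ** Z))"
proof -
  note S = spd_gram_matrix[OF assms(1)] and W = spd_gram_matrix[OF assms(2)]
  have orth: "transpose Z ** X = 0"
    by (rule orthogonal_columns_commute[OF assms(3)])
  have "y = X *v (matrix_inv (transpose X ** X) *v (transpose X *v y))
      + Z *v (matrix_inv (transpose Z ** Z) *v (transpose Z *v y))" for y
  proof -
    obtain a b where "y = X *v a + Z *v b" using spanning by blast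
    then show ?thesis
      by (simp add: matrix_vector_right_distrib matrix_vector_mul_assoc orth assms(3)
          matrix_inv_cancel[OF invertible_spd_matrix[OF S], unfolded matrix_vector_mul_assoc]
          matrix_inv_cancel[OF invertible_spd_matrix[OF W], unfolded matrix_vector_mul_assoc])
  qed
  then have "mat 1 = hcat_matrix X Z
      ** four_block_matrix (matrix_inv (transpose X ** X)) 0 (transpose 0)
           (matrix_inv (transpose Z ** Z))
      ** vcat_matrix (transpose X) (transpose Z)"
    by (simp add: matrix_eq block_congruence_vector_mult transpose_zero)
  moreover have "spd_matrix (mat 1 :: real ^ 'n ^ 'n)"
    by (simp add: spd_matrix_def symmetric_matrix_def)
  ultimately show ?thesis
    using assms S W by unfold_locales (simp_all add: spd_matrix_inv symmetric_matrix_inv)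
qed

section \<open>Comparing two residual sums of squares\<close>

text \<open>
  Once \<open>b = 0\<close> has given \<open>L = L'\<close>, the equation for fixed \<open>b\<close> says that the linear function
  \<open>a \<mapsto> 2 a\<^sup>T L H b\<close> is constant; hence it is zero, and only the forms in \<open>b\<close> remain.
\<close>

lemma shifted_form_eq_iff:
  fixes L L' :: "real ^ 'k ^ 'k" and D D' :: "real ^ 'm ^ 'm" and H :: "real ^ 'm ^ 'k"
  assumes L: "symmetric_matrix L" and L': "symmetric_matrix L'"
    and D: "symmetric_matrix D" and D': "symmetric_matrix D'"
  shows "(\<forall>a b. (a - H *v b) \<bullet> (L *v (a - H *v b)) + b \<bullet> (D *v b)
              = a \<bullet> (L' *v a) + b \<bullet> (D' *v b))
    \<longleftrightarrow> L = L' \<and> L' ** H = 0 \<and> D = D'"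
proof (intro iffI; (elim conjE)?)
  assume eq: "\<forall>a b. (a - H *v b) \<bullet> (L *v (a - H *v b)) + b \<bullet> (D *v b)
              = a \<bullet> (L' *v a) + b \<bullet> (D' *v b)"
  have LL: "L = L'"
    using eq[rule_format, of _ 0] by (intro symmetric_matrix_eqI L L') simp
  have LH: "L *v (H *v b) = 0" for b
  proof -
    let ?h = "H *v b"
    have expand: "(a - ?h) \<bullet> (L *v (a - ?h)) = a \<bullet> (L *v a) - 2 * (a \<bullet> (L *v ?h)) + ?h \<bullet> (L *v ?h)" for a
      by (simp add: matrix_vector_mult_diff_distrib inner_diff
          dot_symmetric_matrix[OF L, of a ?h] inner_commute)
    have *: "?h \<bullet> (L *v ?h) + b \<bullet> (D *v b) - b \<bullet> (D' *v b) = 2 * (a \<bullet> (L *v ?h))" for a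
      using eq[rule_format, of a b] expand[of a] unfolding LL[symmetric] by linarith
    \<comment> \<open>The left side does not depend on \<open>a\<close>, so the value at \<open>a = 0\<close> decides.\<close>
    have "a \<bullet> (L *v ?h) = 0" for a
      using *[of a] *[of 0] by simp
    then show ?thesis using inner_eq_zero_iff by blast
  qed
  then have "L' ** H = 0" by (simp add: LL matrix_mult_eq_0_iff)
  moreover have "D = D'"
  proof (intro symmetric_matrix_eqI D D')
    show "b \<bullet> (D *v b) = b \<bullet> (D' *v b)" for b
      using eq[rule_format, of "H *v b" b] LH[of b] LL by simp
  qed
  ultimately show "L = L' \<and> L' ** H = 0 \<and> D = D'" using LL by simp
next
  assume LL: "L = L'" and "L' ** H = 0" and DD: "D = D'"
  then have LH: "L *v (H *v b) = 0" for b
    by (simp add: matrix_mult_eq_0_iff)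
  show "\<forall>a b. (a - H *v b) \<bullet> (L *v (a - H *v b)) + b \<bullet> (D *v b)
              = a \<bullet> (L' *v a) + b \<bullet> (D' *v b)"
    using dot_symmetric_matrix[OF L, of "H *v _"]
    by (simp add: matrix_vector_mult_diff_distrib inner_diff LH LL[symmetric] DD[symmetric])
qed

theorem theorem4p1:
  fixes X :: "real ^ 'k ^ 'n"
    and Z :: "real ^ 'm ^ 'n"
    and \<Omega> :: "real ^ 'n ^ 'n"
    and \<Gamma> A K1 K2 :: "real ^ 'k ^ 'k"
    and \<Xi> :: "real ^ 'm ^ 'k"
    and \<Delta> :: "real ^ 'm ^ 'm"
  assumes "CARD('k) < CARD('n)"
    and "CARD('m) = CARD('n) - CARD('k)"
    and "rank X = CARD('k)"
    and "transpose X ** Z = 0"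
    and "rank Z = CARD('n) - CARD('k)"
    and "spd_matrix \<Omega>"
    and "\<Omega> = hcat_matrix X Z ** four_block_matrix \<Gamma> \<Xi> (transpose \<Xi>) \<Delta>
               ** vcat_matrix (transpose X) (transpose Z)"
    and "spd_matrix \<Gamma>"
    and "spd_matrix \<Delta>"
    and "A = matrix_inv (\<Gamma> - \<Xi> ** matrix_inv \<Delta> ** transpose \<Xi>)"
    and "spsd_matrix K1"
    and "spsd_matrix K2"
  shows "(\<forall>y. RSS X y \<Omega> K1 = RSS X y (mat 1) K2) \<longleftrightarrow>
     (K1 ** matrix_inv (A + K1) ** A ** matrix_inv (A + K1) ** K1 =
        K2 ** matrix_inv (transpose X ** X + K2) ** (transpose X ** X)
           ** matrix_inv (transpose X ** X + K2) ** K2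
      \<and> K2 ** matrix_inv (transpose X ** X + K2) ** K2 ** \<Xi> = 0
      \<and> \<Delta> = matrix_inv (transpose Z ** Z))"
proof -
  let ?S = "transpose X ** X" and ?W = "transpose Z ** Z"
  let ?H = "\<Xi> ** matrix_inv \<Delta>"
  have rank_Z: "rank Z = CARD('m)" using assms by simp
  interpret \<Omega>: block_covariance X Z \<Omega> \<Gamma> \<Xi> \<Delta>
    by (unfold_locales; fact assms rank_Z spd_matrix_symmetric[OF assms(8)])
  interpret I: block_covariance X Z "mat 1" "matrix_inv ?S" 0 "matrix_inv ?W"
    using \<Omega>.coordinates_exist by (intro block_covariance_identity assms rank_Z) metis
  note S = spd_gram_matrix[OF assms(3)] and W = spd_gram_matrix[OF rank_Z]
  have A: "A = matrix_inv \<Omega>.schur" "spd_matrix A"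
    by (simp_all add: assms \<Omega>.schur_def[symmetric] spd_matrix_inv \<Omega>.spd_schur)
  have inv_inv: "matrix_inv (matrix_inv M) = M" if "spd_matrix M" for M :: "real ^ 'a ^ 'a"
    using that by (intro matrix_inv_eqI invertible_spd_matrix spd_matrix_inv
        matrix_inv_cancel(2))
  have I_schur: "matrix_inv I.schur = ?S"
    by (simp add: I.schur_def inv_inv[OF S])
  let ?L1 = "ridge_residual_form A K1" and ?L2 = "ridge_residual_form ?S K2"
  have RSS_\<Omega>: "RSS X (X *v a + Z *v b) \<Omega> K1 =
      (a - ?H *v b) \<bullet> (?L1 *v (a - ?H *v b)) + b \<bullet> (matrix_inv \<Delta> *v b)" for a b
    by (simp add: \<Omega>.RSS_coordinates assms(11) A \<Omega>.partial_coeff_def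
        flip: matrix_vector_mul_assoc)
  have RSS_I: "RSS X (X *v a + Z *v b) (mat 1) K2 =
      a \<bullet> (?L2 *v a) + b \<bullet> (?W *v b)" for a b
    by (simp add: I.RSS_coordinates assms(12) I_schur I.partial_coeff_def inv_inv[OF W])
  have "(\<forall>y. RSS X y \<Omega> K1 = RSS X y (mat 1) K2) \<longleftrightarrow>
      (\<forall>a b. RSS X (X *v a + Z *v b) \<Omega> K1 = RSS X (X *v a + Z *v b) (mat 1) K2)"
    by (metis \<Omega>.coordinates_exist)
  also have "\<dots> \<longleftrightarrow> ?L1 = ?L2 \<and> ?L2 ** ?H = 0 \<and> matrix_inv \<Delta> = ?W"
    unfolding RSS_\<Omega> RSS_I
    by (intro shifted_form_eq_iff symmetric_ridge_residual_form symmetric_matrix_inv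
        spd_matrix_symmetric assms A S W)
  also have "?L2 ** ?H = 0 \<longleftrightarrow> ?L2 ** \<Xi> = 0"
    unfolding matrix_mult_eq_0_iff matrix_vector_mul_assoc[symmetric]
    using \<Omega>.inverse_\<Delta>(2) by metis
  also have "?L2 ** \<Xi> = 0 \<longleftrightarrow> K2 ** matrix_inv (?S + K2) ** K2 ** \<Xi> = 0"
    by (simp add: matrix_mult_eq_0_iff ridge_residual_form_kernel[OF S assms(12)])
  also have "matrix_inv \<Delta> = ?W \<longleftrightarrow> \<Delta> = matrix_inv ?W"
    using inv_inv[OF W] inv_inv[OF assms(9)] by metis
  finally show ?thesis
    by (simp only: ridge_residual_form_def)
qed

end
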